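(* The following statements hold, where $\lambda$ denotes Lebesgue measure. (i) Let $b\colon\mathbb{R}\to[0,\infty)$ be a bounded nondecreasing function which is non-constant on $[0,\infty)$. Then $\mathsf{E}\,b(Z_p)$ is strictly decreasing in $p\in[1,\infty]$. (ii) Let $a\colon\mathbb{R}\to[0,\infty)$ be a bounded Borel function. Let $r\colon\mathbb{R}\to[0,\infty)$ be a bounded nondecreasing function which is not $\lambda$-constant on the set $\{t\in[0,\infty)\colon a(t)\ne0\}$. Let $b:=ra$ (pointwise product). Then the ratio $$\frac{\mathsf{E}\,b(Z_p)}{\mathsf{E}\,a(Z_p)}$$ is strictly decreasing in $p\in[1,\infty]$.
   Context: For real $p\in[1,\infty)$, let $Z_p:=X_p-\sqrt{p-1}$, where $X_p$ is any nonnegative random variable such that $X_p^2$ has the $\chi^2$ distribution with $p$ degrees of freedom (i.e. the distribution on $(0,\infty)$ with density $\frac{1}{2^{p/2}\Gamma(p/2)}x^{p/2-1}e^{-x/2}$). This is completed by continuity, letting $Z_\infty$ have the centered normal distribution with variance $\frac12$. Given a Borel set $E$ and a real-valued Borel function $h$ defined on a set containing $E$, $h$ is said to be $\lambda$-constant on $E$ if $\lambda(\{x\in E\colon h(x)\ne\ell\})=0$ for some $\ell\in\mathbb{R}$. *)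

theory Defs
  imports "HOL-Probability.Probability"
begin

definition chi_square_density :: "real \<Rightarrow> real \<Rightarrow> real" where
  "chi_square_density p x =
     (if x > 0 then 1 / (2 powr (p / 2) * Gamma (p / 2)) * x powr (p / 2 - 1) * exp (- x / 2)
      else 0)"

definition chi_variable :: "real \<Rightarrow> 'a measure \<Rightarrow> ('a \<Rightarrow> real) \<Rightarrow> bool" where
  "chi_variable p M X \<longleftrightarrow>
     X \<in> borel_measurable M \<and> (\<forall>\<omega>\<in>space M. 0 \<le> X \<omega>) \<and>
     distributed M lborel (\<lambda>\<omega>. (X \<omega>)\<^sup>2) (\<lambda>x. ennreal (chi_square_density p x))"

text \<open>
  The index ranges over the extended reals; only indices in \<open>[1, \<infinity>]\<close> are meaningful.
  The second parameter of \<^const>\<open>normal_density\<close> is the standard deviation, so the limit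
  law at \<open>\<infinity>\<close> has variance \<open>1/2\<close>.
\<close>

definition Z_variable :: "ereal \<Rightarrow> 'a measure \<Rightarrow> ('a \<Rightarrow> real) \<Rightarrow> bool" where
  "Z_variable p M Z \<longleftrightarrow>
     (if p = \<infinity> then distributed M lborel Z (\<lambda>x. ennreal (normal_density 0 (sqrt (1 / 2)) x))
      else \<exists>X. chi_variable (real_of_ereal p) M X \<and>
               (\<forall>\<omega>\<in>space M. Z \<omega> = X \<omega> - sqrt (real_of_ereal p - 1)))"

definition lebesgue_constant_on :: "(real \<Rightarrow> real) \<Rightarrow> real set \<Rightarrow> bool" where
  "lebesgue_constant_on h E \<longleftrightarrow> (\<exists>l. {x \<in> E. h x \<noteq> l} \<in> null_sets lborel)"

end

theory Submission
  imports Defs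
begin

text \<open>
  For \<open>p < q\<close> the densities of \<open>Z\<^sub>p\<close> and \<open>Z\<^sub>q\<close> satisfy \<open>f\<^sub>p = \<rho> f\<^sub>q\<close> with \<open>\<rho>\<close> nondecreasing,
  and strictly increasing on \<open>(0, \<infinity>)\<close>: with \<open>s = \<surd>(p - 1)\<close>, the logarithmic derivative of \<open>f\<^sub>p\<close>
  is \<open>- z - z s / (z + s)\<close>, whose derivative in \<open>s\<close> is \<open>- z\<^sup>2 / (z + s)\<^sup>2\<close>.

  Let \<open>c\<close> be the ratio of the expectations of \<open>ra\<close> and \<open>a\<close> at \<open>q\<close>, so that \<open>\<integral> f\<^sub>q (r - c) a = 0\<close>,
  and let \<open>\<kappa>\<close> be the value of \<open>\<rho>\<close> where \<open>r - c\<close> changes sign. Then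
  \<open>\<integral> f\<^sub>p (r - c) a = \<integral> f\<^sub>q (r - c) (\<rho> - \<kappa>) a \<ge> 0\<close>, and equality forces \<open>r = c\<close> almost everywhere
  on \<open>{t > 0. a t \<noteq> 0}\<close>, which is (ii). For (i), take \<open>a = 1\<close>. A nondecreasing \<open>b\<close> may be
  non-constant on \<open>[0, \<infinity>)\<close> merely through a jump at \<open>0\<close>; in the case of equality, however,
  \<open>b = c\<close> on \<open>(0, \<infinity>)\<close> gives \<open>b \<le> c\<close> everywhere, and as the mean of \<open>b\<close> at \<open>q > 1\<close> is \<open>c\<close> and
  \<open>f\<^sub>q\<close> is positive to the left of \<open>0\<close>, also \<open>b 0 = c\<close>.
\<close>

section \<open>Explicit densities of the shifted chi laws and of their normal limit\<close>

definition Z_support :: "ereal \<Rightarrow> real set" where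
  "Z_support p = (if p = \<infinity> then UNIV else {- sqrt (real_of_ereal p - 1)<..})"

text \<open>For finite \<open>p\<close> this is the chi-square density transported by y = (z + s)^2;
  the factor \<open>2 * (z + s)\<close> is the Jacobian.\<close>

definition Z_density :: "ereal \<Rightarrow> real \<Rightarrow> real" where
  "Z_density p z =
     (if p = \<infinity> then normal_density 0 (sqrt (1 / 2)) z
      else let s = sqrt (real_of_ereal p - 1) in
        if - s < z then 2 * (z + s) * chi_square_density (real_of_ereal p) ((z + s)\<^sup>2) else 0)"

text \<open>The logarithm of the density on the support, up to an additive constant.\<close>

definition Z_exponent :: "ereal \<Rightarrow> real \<Rightarrow> real" where
  "Z_exponent p z =
     (if p = \<infinity> then - z\<^sup>2
      else let s = sqrt (real_of_ereal p - 1) in s\<^sup>2 * ln (z + s) - (z + s)\<^sup>2 / 2)"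

lemma chi_square_density_nonneg: "p > 0 \<Longrightarrow> 0 \<le> chi_square_density p x"
  by (auto simp: chi_square_density_def
      intro!: mult_nonneg_nonneg divide_nonneg_nonneg less_imp_le[OF Gamma_real_pos])

lemma chi_square_density_measurable [measurable]: "chi_square_density p \<in> borel_measurable borel"
  unfolding chi_square_density_def[abs_def] by measurable

lemma Z_density_measurable [measurable]: "Z_density p \<in> borel_measurable borel"
  unfolding Z_density_def[abs_def] Let_def by measurable

text \<open>The Jacobian raises the power of z + s from P - 2 to P - 1 = s^2, which yields the
  logarithmic term of the exponent. The Gamma normalisation is hidden in \<open>K\<close>, since a
  positive constant does not affect the monotonicity of a density ratio.\<close>

lemma Z_density_exp:
  assumes "1 \<le> p"
  obtains K where "K > 0"
    "\<And>z. Z_density p z = (if z \<in> Z_support p then K * exp (Z_exponent p z) else 0)"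
proof (cases "p = \<infinity>")
  case True
  show ?thesis
    by (rule that[of "1 / sqrt pi"])
       (auto simp: True Z_density_def Z_support_def Z_exponent_def normal_density_def)
next
  case False
  with assms obtain P where P: "p = ereal P" "1 \<le> P"
    by (cases p) auto
  define s where "s = sqrt (P - 1)"
  have s2: "s\<^sup>2 = P - 1" using P by (simp add: s_def)
  define K where "K = 2 / (2 powr (P / 2) * Gamma (P / 2))"
  have "K > 0" using P by (auto simp: K_def intro!: divide_pos_pos mult_pos_pos Gamma_real_pos)
  moreover have "Z_density p z = K * exp (Z_exponent p z)" if "- s < z" for z
  proof -
    have zs: "z + s > 0" using that by simp
    have "((z + s)\<^sup>2) powr (P / 2 - 1) = ((z + s) powr 2) powr (P / 2 - 1)"
      using zs by simp
    also have "\<dots> = (z + s) powr (P - 2)"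
      by (simp only: powr_powr) (simp add: algebra_simps)
    also have "(z + s) * \<dots> = (z + s) powr (P - 1)"
      using zs by (simp add: powr_mult_base)
    finally have "(z + s) * ((z + s)\<^sup>2) powr (P / 2 - 1) = exp (s\<^sup>2 * ln (z + s))"
      using zs unfolding s2 by (simp add: powr_def)
    moreover have "Z_density p z =
        K * ((z + s) * ((z + s)\<^sup>2) powr (P / 2 - 1)) * exp (- (z + s)\<^sup>2 / 2)"
      using zs that P by (simp add: Z_density_def chi_square_density_def K_def flip: s_def)
    moreover have "Z_exponent p z = s\<^sup>2 * ln (z + s) + - (z + s)\<^sup>2 / 2"
      using P by (simp add: Z_exponent_def flip: s_def)
    ultimately show ?thesis
      by (simp only: exp_add mult.assoc)
  qed
  moreover have "Z_density p z = 0" if "\<not> - s < z" for z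
    using that P by (simp add: Z_density_def flip: s_def)
  ultimately show ?thesis
    using P by (intro that[of K]) (auto simp: Z_support_def simp flip: s_def)
qed

lemma Z_density_nonneg: "1 \<le> p \<Longrightarrow> 0 \<le> Z_density p z"
  by (rule Z_density_exp[of p]) auto

lemma Z_density_pos: "1 \<le> p \<Longrightarrow> z \<in> Z_support p \<Longrightarrow> 0 < Z_density p z"
  by (rule Z_density_exp[of p]) auto

lemma Z_support_pos: "1 \<le> p \<Longrightarrow> 0 < z \<Longrightarrow> z \<in> Z_support p"
  by (cases p) (auto simp: Z_support_def intro: le_less_trans[of _ 0])

lemma Z_support_upward: "z \<in> Z_support p \<Longrightarrow> z \<le> w \<Longrightarrow> w \<in> Z_support p"
  by (auto simp: Z_support_def split: if_splits)

lemma Z_support_mono: "1 \<le> p \<Longrightarrow> p \<le> q \<Longrightarrow> Z_support p \<subseteq> Z_support q"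
  by (cases p; cases q) (auto simp: Z_support_def intro: le_less_trans)

text \<open>Strictness of \<open>1 < q\<close> matters: at index 1 the support is just the positive
  half-line. Points of the support to the left of 0 are what later excludes a jump of
  \<open>b\<close> at 0.\<close>

lemma Z_support_neg:
  assumes "1 < q"
  obtains e where "0 < e" "\<And>x. - e < x \<Longrightarrow> x \<in> Z_support q"
proof (cases "q = \<infinity>")
  case True
  then show ?thesis using that[of 1] by (simp add: Z_support_def)
next
  case False
  with assms obtain Q where "q = ereal Q" "1 < Q" by (cases q) auto
  then show ?thesis by (intro that[of "sqrt (Q - 1)"]) (auto simp: Z_support_def)
qed

section \<open>Monotone likelihood ratio\<close>

text \<open>With t = sqrt(q - 1) the derivative is z^2 (t - s) / ((z + s)(z + t)). Its limit z^2 /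
  (z + s) as t tends to infinity is the derivative for \<open>q = \<infinity>\<close>.\<close>

lemma Z_exponent_diff_deriv:
  assumes "1 \<le> p" "p < q" "z \<in> Z_support p"
  obtains d where "((\<lambda>z. Z_exponent p z - Z_exponent q z) has_real_derivative d) (at z)"
    "0 \<le> d" "0 < z \<Longrightarrow> 0 < d"
proof -
  obtain P where P: "p = ereal P" "1 \<le> P"
    using assms by (cases p) auto
  define s where "s = sqrt (P - 1)"
  have s: "0 \<le> s" "z + s > 0" "real_of_ereal p - 1 = s\<^sup>2"
    using P assms(3) by (auto simp: s_def Z_support_def)
  show ?thesis
  proof (cases "q = \<infinity>")
    case True
    have "((\<lambda>z. s\<^sup>2 * ln (z + s) - (z + s)\<^sup>2 / 2 - (- z\<^sup>2)) has_real_derivative z\<^sup>2 / (z + s)) (at z)"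
      using s by (auto intro!: derivative_eq_intros simp: field_simps power2_eq_square)
    moreover have "0 \<le> z\<^sup>2 / (z + s)" "0 < z \<Longrightarrow> 0 < z\<^sup>2 / (z + s)"
      using s by auto
    ultimately show ?thesis
      using s True P by (intro that[of "z\<^sup>2 / (z + s)"]) (auto simp: Z_exponent_def Let_def)
  next
    case False
    with assms P obtain Q where Q: "q = ereal Q" "P < Q"
      by (cases q) auto
    define t where "t = sqrt (Q - 1)"
    have t: "s < t" "z + t > 0" "real_of_ereal q - 1 = t\<^sup>2"
      using P Q s(2) by (auto simp: s_def t_def intro: less_trans)
    have t2: "z + t > 0" using s t(1) by simp
    define d where "d = z\<^sup>2 * (t - s) / ((z + s) * (z + t))"
    have "((\<lambda>z. s\<^sup>2 * ln (z + s) - (z + s)\<^sup>2 / 2 - (t\<^sup>2 * ln (z + t) - (z + t)\<^sup>2 / 2))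
        has_real_derivative s\<^sup>2 / (z + s) - (z + s) - (t\<^sup>2 / (z + t) - (z + t))) (at z)"
      using s t2 by (auto intro!: derivative_eq_intros simp: add_divide_distrib)
    also have "s\<^sup>2 / (z + s) - (z + s) - (t\<^sup>2 / (z + t) - (z + t)) = d"
      using s(2) t2 unfolding d_def
      by (simp add: divide_simps) (simp add: algebra_simps power2_eq_square)
    finally have "((\<lambda>z. s\<^sup>2 * ln (z + s) - (z + s)\<^sup>2 / 2 - (t\<^sup>2 * ln (z + t) - (z + t)\<^sup>2 / 2))
        has_real_derivative d) (at z)" .
    moreover have "0 \<le> d" "0 < z \<Longrightarrow> 0 < d"
      using s t2 t(1) by (auto simp: d_def)
    ultimately show ?thesis
      using s t P Q t2 by (intro that[of d]) (auto simp: Z_exponent_def Let_def)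
  qed
qed

text \<open>Stated as a product rather than a quotient, so that it also covers the points where the
  density at \<open>q\<close> vanishes.\<close>

lemma Z_density_ratio:
  assumes "1 \<le> p" "p < q"
  obtains \<rho> :: "real \<Rightarrow> real"
  where "mono \<rho>" "strict_mono_on {0<..} \<rho>" "\<And>z. 0 \<le> \<rho> z"
    "\<And>z. Z_density p z = \<rho> z * Z_density q z"
proof -
  have q: "1 \<le> q" using assms by simp
  obtain K where K: "K > 0"
    "\<And>z. Z_density p z = (if z \<in> Z_support p then K * exp (Z_exponent p z) else 0)"
    using Z_density_exp[OF assms(1)] by blast
  obtain L where L: "L > 0"
    "\<And>z. Z_density q z = (if z \<in> Z_support q then L * exp (Z_exponent q z) else 0)"
    using Z_density_exp[OF q] by blast
  have sub: "z \<in> Z_support p \<Longrightarrow> z \<in> Z_support q" for z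
    using Z_support_mono[OF assms(1) less_imp_le[OF assms(2)]] by auto
  define D where "D z = Z_exponent p z - Z_exponent q z" for z
  \<comment> \<open>The value 0 off \<open>Z_support p\<close> is forced where only the density at
    \<open>q\<close> is positive. It keeps \<rho> nondecreasing because the support is closed
    upwards.\<close>
  define \<rho> where "\<rho> z = (if z \<in> Z_support p then K / L * exp (D z) else 0)" for z
  have der: "\<exists>d. (D has_real_derivative d) (at z) \<and> 0 \<le> d \<and> (0 < z \<longrightarrow> 0 < d)"
    if "z \<in> Z_support p" for z
    using Z_exponent_diff_deriv[OF assms that] unfolding D_def by metis
  have D_mono: "D x \<le> D y" if "x \<in> Z_support p" "x \<le> y" for x y
    by (rule DERIV_nonneg_imp_nondecreasing[OF that(2)])
       (meson der Z_support_upward that(1))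
  have D_strict: "D x < D y" if "0 < x" "x < y" for x y
    by (rule DERIV_pos_imp_increasing[OF that(2)])
       (meson der Z_support_pos assms(1) less_le_trans that(1))
  have "mono \<rho>"
  proof (rule monoI)
    fix x y :: real assume "x \<le> y"
    then show "\<rho> x \<le> \<rho> y"
      using D_mono[of x y] Z_support_upward[of x p y] K(1) L(1)
      by (auto simp: \<rho>_def intro!: mult_left_mono divide_right_mono)
  qed
  moreover have "strict_mono_on {0<..} \<rho>"
  proof (rule strict_mono_onI)
    fix x y :: real assume "x \<in> {0<..}" "y \<in> {0<..}" "x < y"
    then show "\<rho> x < \<rho> y"
      using D_strict[of x y] Z_support_pos[OF assms(1)] K(1) L(1)
      by (auto simp: \<rho>_def intro!: mult_strict_left_mono divide_strict_right_mono)
  qed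
  moreover have "0 \<le> \<rho> z" for z using K(1) L(1) by (simp add: \<rho>_def)
  moreover have "Z_density p z = \<rho> z * Z_density q z" for z
    using K L sub by (simp add: \<rho>_def D_def exp_diff)
  ultimately show ?thesis using that by blast
qed

section \<open>Expectations as integrals against the density\<close>

lemma chi_square_substitution:
  fixes h :: "real \<Rightarrow> real"
  assumes [measurable]: "h \<in> borel_measurable borel"
    and int: "integrable lborel (\<lambda>y. chi_square_density p y * h (sqrt y - s))"
  shows "integrable lborel
      (\<lambda>z. if - s < z then 2 * (z + s) * chi_square_density p ((z + s)\<^sup>2) * h z else 0)"
      (is "integrable _ ?g")
    and "(\<integral>z. (if - s < z then 2 * (z + s) * chi_square_density p ((z + s)\<^sup>2) * h z else 0) \<partial>lborel) =
      (\<integral>y. chi_square_density p y * h (sqrt y - s) \<partial>lborel)"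
proof -
  let ?f = "\<lambda>y. chi_square_density p y * h (sqrt y - s)"
  have img: "(\<lambda>z. (z + s)\<^sup>2) ` {- s<..} = {0<..}"
  proof (intro equalityI subsetI)
    fix y :: real assume "y \<in> {0<..}"
    then show "y \<in> (\<lambda>z. (z + s)\<^sup>2) ` {- s<..}"
      by (intro image_eqI[of _ _ "sqrt y - s"]) auto
  qed auto
  have inj: "inj_on (\<lambda>z. (z + s)\<^sup>2) {- s<..}"
    by (rule inj_onI) (simp add: power2_eq_iff_nonneg)
  \<comment> \<open>Both integrands vanish off the two half-lines that the substitution matches, so
    integrals over these sets are integrals over the whole line.\<close>
  have f_ind: "indicator {0<..} y *\<^sub>R ?f y = ?f y" for y
    by (simp add: chi_square_density_def)
  have g_ind: "indicator {- s<..} z *\<^sub>R (\<bar>2 * (z + s)\<bar> * ?f ((z + s)\<^sup>2)) = ?g z" for z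
    by (auto simp: abs_mult)
  have [measurable]: "?g \<in> borel_measurable borel" by measurable
  \<comment> \<open>The change of variables theorem concerns the completed measure; for Borel
    functions, integrability and integrals agree with those for \<open>lborel\<close>.\<close>
  have f_abs: "?f absolutely_integrable_on {0<..}"
    unfolding set_integrable_def f_ind using int by (simp add: integrable_completion)
  have f_int: "integral {0<..} ?f = (\<integral>y. ?f y \<partial>lborel)"
    using set_lebesgue_integral_eq_integral(2)[OF f_abs]
    unfolding set_lebesgue_integral_def f_ind by (simp add: integral_completion)
  have "(\<lambda>z. \<bar>2 * (z + s)\<bar> * ?f ((z + s)\<^sup>2)) absolutely_integrable_on {- s<..} \<and>
      integral {- s<..} (\<lambda>z. \<bar>2 * (z + s)\<bar> * ?f ((z + s)\<^sup>2)) = (\<integral>y. ?f y \<partial>lborel)"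
    by (subst has_absolute_integral_change_of_variables_1'[OF _ _ inj])
       (auto intro!: derivative_eq_intros simp: img f_abs f_int)
  then have A: "(\<lambda>z. \<bar>2 * (z + s)\<bar> * ?f ((z + s)\<^sup>2)) absolutely_integrable_on {- s<..}"
    and B: "integral {- s<..} (\<lambda>z. \<bar>2 * (z + s)\<bar> * ?f ((z + s)\<^sup>2)) = (\<integral>y. ?f y \<partial>lborel)"
    by auto
  show "integrable lborel ?g"
    using A unfolding set_integrable_def g_ind by (simp add: integrable_completion)
  show "(\<integral>z. ?g z \<partial>lborel) = (\<integral>y. ?f y \<partial>lborel)"
    using set_lebesgue_integral_eq_integral(2)[OF A] B
    unfolding set_lebesgue_integral_def g_ind by (simp add: integral_completion)
qed

lemma Z_expectation:
  fixes h :: "real \<Rightarrow> real"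
  assumes "prob_space M" "Z_variable p M Z" "1 \<le> p"
    and h [measurable]: "h \<in> borel_measurable borel" and bdd: "bounded (range h)"
  shows "integrable lborel (\<lambda>x. Z_density p x * h x)"
    and "(\<integral>\<omega>. h (Z \<omega>) \<partial>M) = (\<integral>x. Z_density p x * h x \<partial>lborel)"
proof -
  interpret prob_space M by fact
  obtain B where B: "\<And>x. \<bar>h x\<bar> \<le> B" using bdd by (auto simp: bounded_iff)
  have "integrable lborel (\<lambda>x. Z_density p x * h x) \<and>
    (\<integral>\<omega>. h (Z \<omega>) \<partial>M) = (\<integral>x. Z_density p x * h x \<partial>lborel)"
  proof (cases "p = \<infinity>")
    case True
    then have D: "distributed M lborel Z (\<lambda>x. ennreal (Z_density p x))"
      using assms(2) by (simp add: Z_variable_def Z_density_def)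
    have [measurable]: "Z \<in> borel_measurable M"
      using D by (simp add: distributed_def)
    have "integrable M (\<lambda>\<omega>. h (Z \<omega>))"
      by (rule integrable_const_bound[of _ B]) (auto simp: B)
    then show ?thesis
      using distributed_integrable[OF D] distributed_integral[OF D] Z_density_nonneg[OF assms(3)]
      by simp
  next
    case False
    then obtain P where P: "p = ereal P" "1 \<le> P"
      using assms(3) by (cases p) auto
    define s where "s = sqrt (P - 1)"
    obtain X where X [measurable]: "X \<in> borel_measurable M"
      and X0: "\<And>\<omega>. \<omega> \<in> space M \<Longrightarrow> 0 \<le> X \<omega>"
      and D: "distributed M lborel (\<lambda>\<omega>. (X \<omega>)\<^sup>2) (\<lambda>x. ennreal (chi_square_density P x))"
      and Z: "\<And>\<omega>. \<omega> \<in> space M \<Longrightarrow> Z \<omega> = X \<omega> - s"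
      using assms(2) P by (auto simp: Z_variable_def chi_variable_def s_def)
    \<comment> \<open>Only the law of X^2 is given, so h(Z) is rewritten as a function of X^2;
      nonnegativity of \<open>X\<close> lets the square root recover it.\<close>
    let ?k = "\<lambda>y. h (sqrt y - s)"
    have hZ: "h (Z \<omega>) = ?k ((X \<omega>)\<^sup>2)" if "\<omega> \<in> space M" for \<omega>
      using X0 Z that by simp
    have "integrable M (\<lambda>\<omega>. ?k ((X \<omega>)\<^sup>2))"
      by (rule integrable_const_bound[of _ B]) (auto simp: B)
    then have int: "integrable lborel (\<lambda>y. chi_square_density P y * ?k y)"
      using distributed_integrable[OF D, of ?k] chi_square_density_nonneg[of P] P by simp
    have "(\<integral>\<omega>. h (Z \<omega>) \<partial>M) = (\<integral>\<omega>. ?k ((X \<omega>)\<^sup>2) \<partial>M)"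
      using hZ by (intro Bochner_Integration.integral_cong) auto
    also have "\<dots> = (\<integral>y. chi_square_density P y * ?k y \<partial>lborel)"
      using distributed_integral[OF D, of ?k] chi_square_density_nonneg[of P] P by simp
    finally have eq: "(\<integral>\<omega>. h (Z \<omega>) \<partial>M) = (\<integral>y. chi_square_density P y * ?k y \<partial>lborel)" .
    have "Z_density p z * h z =
        (if - s < z then 2 * (z + s) * chi_square_density P ((z + s)\<^sup>2) * h z else 0)" for z
      using P by (simp add: Z_density_def flip: s_def)
    then show ?thesis
      using chi_square_substitution[OF h int] eq by simp
  qed
  then show "integrable lborel (\<lambda>x. Z_density p x * h x)"
    and "(\<integral>\<omega>. h (Z \<omega>) \<partial>M) = (\<integral>x. Z_density p x * h x \<partial>lborel)" by auto
qed

section \<open>Comparison of integrals under a monotone density ratio\<close>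

text \<open>A variant of Chebyshev's association inequality: subtracting \<kappa> times the
  vanishing integral turns the integrand into a nonnegative weight times two factors that change
  sign at the same place.\<close>

lemma monotone_ratio_integral:
  fixes f g \<rho> a r :: "real \<Rightarrow> real"
  assumes f: "\<And>x. f x = \<rho> x * g x" and g: "\<And>x. 0 \<le> g x" "\<And>x. 0 < x \<Longrightarrow> 0 < g x"
    and \<rho>: "mono \<rho>" "strict_mono_on {0<..} \<rho>" "\<And>x. 0 \<le> \<rho> x"
    and a: "\<And>x. 0 \<le> a x" and r: "mono r"
    and int_f: "integrable lborel (\<lambda>x. f x * ((r x - c) * a x))"
    and int_g: "integrable lborel (\<lambda>x. g x * ((r x - c) * a x))"
    and zero: "(\<integral>x. g x * ((r x - c) * a x) \<partial>lborel) = 0"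
  shows "0 \<le> (\<integral>x. f x * ((r x - c) * a x) \<partial>lborel)" (is "0 \<le> ?I")
    and "(\<integral>x. f x * ((r x - c) * a x) \<partial>lborel) = 0 \<Longrightarrow>
      AE x in lborel. 0 < x \<longrightarrow> a x \<noteq> 0 \<longrightarrow> r x = c"
proof -
  let ?w = "\<lambda>x. g x * ((r x - c) * a x)"
  have "0 \<le> ?I \<and> (?I = 0 \<longrightarrow> (AE x in lborel. 0 < x \<longrightarrow> a x \<noteq> 0 \<longrightarrow> r x = c))"
  \<comment> \<open>If \<open>r\<close> never exceeds \<open>c\<close>, a suitable \<kappa> might
    have to bound \<rho> from above, and \<rho> may be unbounded. In this case, however,
    \<open>?w\<close> has constant sign and integral 0, hence vanishes almost everywhere.\<close>
  proof (cases "\<forall>x. r x \<le> c")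
    case True
    then have nn: "0 \<le> - ?w x" for x
      using g(1)[of x] a[of x] by (simp add: mult_nonneg_nonpos mult_nonpos_nonneg)
    have "AE x in lborel. - ?w x = 0"
      by (subst integral_nonneg_eq_0_iff_AE[symmetric]) (use int_g nn zero in auto)
    then have AE: "AE x in lborel. ?w x = 0" by simp
    have "AE x in lborel. f x * ((r x - c) * a x) = 0"
      using AE by eventually_elim (auto simp: f)
    then have "?I = 0"
      by (rule integral_eq_zero_AE)
    moreover have "AE x in lborel. 0 < x \<longrightarrow> a x \<noteq> 0 \<longrightarrow> r x = c"
      using AE by eventually_elim (use g(2) in force)
    ultimately show ?thesis by simp
  next
    case False
    \<comment> \<open>The second property makes the set of positive points with \<rho> = \<kappa>
      negligible, which the equality case needs.\<close>
    obtain \<kappa> where \<kappa>: "\<And>x. 0 \<le> (r x - c) * (\<rho> x - \<kappa>)"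
      and inj: "\<And>x y. 0 < x \<Longrightarrow> 0 < y \<Longrightarrow> \<rho> x = \<kappa> \<Longrightarrow> \<rho> y = \<kappa> \<Longrightarrow> x = y"
    proof -
      have inj: "x = y" if "0 < x" "0 < y" "\<rho> x = \<kappa>" "\<rho> y = \<kappa>" for x y \<kappa>
        using strict_mono_on_imp_inj_on[OF \<rho>(2)] that by (auto dest: inj_onD)
      show ?thesis
      proof (cases "\<forall>x. c \<le> r x")
        case True
        then show ?thesis
          \<comment> \<open>Without a sign change any negative \<kappa> works, as \<rho> is
            nonnegative.\<close>
          using that[of "- 1"] inj \<rho>(3) by (simp add: add_nonneg_nonneg)
      next
        case False
        \<comment> \<open>\<open>Sup T\<close> is the point where \<open>r - c\<close> changes sign.
          On which side of \<open>c\<close> the value of \<open>r\<close> at that point lies is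
          irrelevant, because the factor \<rho> - \<kappa> is 0 there.\<close>
        define T where "T = {x. r x < c}"
        obtain x\<^sub>1 where x1: "r x\<^sub>1 > c" using \<open>\<not> (\<forall>x. r x \<le> c)\<close> by (auto simp: not_le)
        have ub: "y \<le> x" if "r x \<ge> c" "y \<in> T" for x y
          using that monoD[OF r, of x y] by (force simp: T_def)
        have ne: "T \<noteq> {}" using False by (auto simp: T_def not_le)
        have bdd: "bdd_above T" using ub[of x\<^sub>1] x1 by (auto intro!: bdd_aboveI)
        have "0 \<le> (r x - c) * (\<rho> x - \<rho> (Sup T))" for x
        proof (cases "r x < c")
          case True
          then have "x \<le> Sup T" using bdd by (auto simp: T_def intro: cSup_upper)
          then show ?thesis using True monoD[OF \<rho>(1)] by (simp add: mult_nonpos_nonpos)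
        next
          case False
          then have "Sup T \<le> x" using ub ne by (auto intro: cSup_least)
          then show ?thesis using False monoD[OF \<rho>(1)] by simp
        qed
        then show ?thesis using that inj by blast
      qed
    qed
    let ?v = "\<lambda>x. f x * ((r x - c) * a x) - \<kappa> * ?w x"
    have v: "?v x = g x * a x * ((r x - c) * (\<rho> x - \<kappa>))" for x
      by (simp add: f algebra_simps)
    have nn: "0 \<le> ?v x" for x
      unfolding v using g(1) a \<kappa> by simp
    have int_v: "integrable lborel ?v" using int_f int_g by simp
    have I: "(\<integral>x. ?v x \<partial>lborel) = ?I"
      using int_f int_g zero by simp
    have "AE x in lborel. 0 < x \<longrightarrow> a x \<noteq> 0 \<longrightarrow> r x = c" if "?I = 0"
    proof -
      have v0: "AE x in lborel. ?v x = 0"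
        by (subst integral_nonneg_eq_0_iff_AE[symmetric]) (use int_v nn I that in auto)
      \<comment> \<open>Off this set, for positive \<open>x\<close>, a zero of \<open>?v\<close>
        with \<open>a x \<noteq> 0\<close> can only come from the factor
        \<open>r x - c\<close>.\<close>
      have "finite {x. 0 < x \<and> \<rho> x = \<kappa>}"
      proof (cases "\<exists>x. 0 < x \<and> \<rho> x = \<kappa>")
        case True
        then obtain x where "0 < x" "\<rho> x = \<kappa>" by blast
        then have "{x. 0 < x \<and> \<rho> x = \<kappa>} \<subseteq> {x}" using inj by blast
        then show ?thesis by (rule finite_subset) simp
      next
        case False
        then have "{x. 0 < x \<and> \<rho> x = \<kappa>} = {}" by blast
        then show ?thesis by (simp only: finite.emptyI)
      qed
      then have "AE x in lborel. x \<notin> {x. 0 < x \<and> \<rho> x = \<kappa>}"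
        by (intro AE_not_in finite_imp_null_set_lborel)
      with v0 show ?thesis
        by eventually_elim (use v g(2) in force)
    qed
    then show ?thesis
      using Bochner_Integration.integral_nonneg[of lborel ?v] nn I by auto
  qed
  then show "0 \<le> ?I" and "?I = 0 \<Longrightarrow> AE x in lborel. 0 < x \<longrightarrow> a x \<noteq> 0 \<longrightarrow> r x = c"
    by auto
qed

lemma bounded_range_mult:
  fixes h k :: "'a \<Rightarrow> real"
  assumes "bounded (range h)" "bounded (range k)"
  shows "bounded (range (\<lambda>x. h x * k x))"
proof -
  obtain A B where "\<And>x. \<bar>h x\<bar> \<le> A" "\<And>x. \<bar>k x\<bar> \<le> B"
    using assms by (auto simp: bounded_iff)
  then have "\<bar>h x * k x\<bar> \<le> A * B" for x
    unfolding abs_mult by (intro mult_mono order_trans[OF abs_ge_zero]) auto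
  then show ?thesis by (auto simp: bounded_iff)
qed

text \<open>A nonempty open interval has positive measure. This turns almost-everywhere equalities
  into equalities at chosen points, which monotonicity then spreads.\<close>

lemma AE_lborel_interval_witness:
  fixes x y :: real
  assumes "AE z in lborel. P z" "x < y"
  obtains z where "x < z" "z < y" "P z"
proof -
  have "\<not> (AE z in lborel. z \<notin> {x<..<y})"
    using assms(2) by (subst AE_iff_null_sets[symmetric]) (auto simp: null_sets_def)
  moreover have "AE z in lborel. z \<notin> {x<..<y}" if "\<And>z. x < z \<Longrightarrow> z < y \<Longrightarrow> \<not> P z"
    using assms(1) by eventually_elim (use that in auto)
  ultimately show ?thesis using that by blast
qed

section \<open>Strict decrease of the expectations and of their ratios\<close>

theorem proposition1p5:
  fixes M :: "ereal \<Rightarrow> 'a measure" and Z :: "ereal \<Rightarrow> 'a \<Rightarrow> real"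
  assumes "\<And>p. 1 \<le> p \<Longrightarrow> prob_space (M p)"
    and "\<And>p. 1 \<le> p \<Longrightarrow> Z_variable p (M p) (Z p)"
  shows "(\<forall>b :: real \<Rightarrow> real.
            (\<forall>t. 0 \<le> b t) \<and> bounded (range b) \<and> mono b \<and> \<not> b constant_on {0..} \<longrightarrow>
            strict_antimono_on {1..} (\<lambda>p. \<integral>\<omega>. b (Z p \<omega>) \<partial>M p))
       \<and> (\<forall>(a :: real \<Rightarrow> real) (r :: real \<Rightarrow> real).
            (\<forall>t. 0 \<le> a t) \<and> bounded (range a) \<and> a \<in> borel_measurable borel \<and>
            (\<forall>t. 0 \<le> r t) \<and> bounded (range r) \<and> mono r \<and>
            \<not> lebesgue_constant_on r {t \<in> {0..}. a t \<noteq> 0} \<longrightarrow>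
            strict_antimono_on {1..}
              (\<lambda>p. (\<integral>\<omega>. r (Z p \<omega>) * a (Z p \<omega>) \<partial>M p) / (\<integral>\<omega>. a (Z p \<omega>) \<partial>M p)))"
proof (intro conjI allI impI)
  have int: "integrable lborel (\<lambda>x. Z_density p x * h x)"
    and ex: "(\<integral>\<omega>. h (Z p \<omega>) \<partial>M p) = (\<integral>x. Z_density p x * h x \<partial>lborel)"
    if "1 \<le> p" "h \<in> borel_measurable borel" "bounded (range h)" for p and h :: "real \<Rightarrow> real"
    using Z_expectation[OF assms(1)[OF that(1)] assms(2)[OF that(1)] that] by auto
  \<comment> \<open>Common to both claims. The hypothesis \<open>zero\<close> will hold by taking
    \<open>c\<close> to be the expectation, or the ratio of expectations, at the larger index
    \<open>q\<close>.\<close>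
  have compare: "0 \<le> (\<integral>x. Z_density p x * ((r x - c) * a x) \<partial>lborel)"
      "(\<integral>x. Z_density p x * ((r x - c) * a x) \<partial>lborel) = 0 \<Longrightarrow>
        AE x in lborel. 0 < x \<longrightarrow> a x \<noteq> 0 \<longrightarrow> r x = c"
    if pq: "1 \<le> p" "p < q" and a: "\<And>x. 0 \<le> a x" "bounded (range a)" "a \<in> borel_measurable borel"
      and r: "mono r" "bounded (range r)"
      and zero: "(\<integral>x. Z_density q x * ((r x - c) * a x) \<partial>lborel) = 0"
    for p q c and a r :: "real \<Rightarrow> real"
  proof -
    have q: "1 \<le> q" using pq by simp
    have [measurable]: "a \<in> borel_measurable borel" "r \<in> borel_measurable borel"
      using a r by (auto intro: borel_measurable_mono)
    have "bounded (range (\<lambda>x. r x - c))"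
      using bounded_translation[OF r(2), of "- c"] by (simp add: image_image)
    then have bdd: "bounded (range (\<lambda>x. (r x - c) * a x))"
      using a(2) by (rule bounded_range_mult)
    have meas: "(\<lambda>x. (r x - c) * a x) \<in> borel_measurable borel" by measurable
    obtain \<rho> where \<rho>: "mono \<rho>" "strict_mono_on {0<..} \<rho>" "\<And>z. 0 \<le> \<rho> z"
      and eq: "\<And>z. Z_density p z = \<rho> z * Z_density q z"
      using Z_density_ratio[OF pq] by blast
    note R = monotone_ratio_integral[OF eq Z_density_nonneg[OF q]
        Z_density_pos[OF q Z_support_pos[OF q]] \<rho> a(1) r(1) int[OF pq(1) meas bdd]
        int[OF q meas bdd] zero]
    show "0 \<le> (\<integral>x. Z_density p x * ((r x - c) * a x) \<partial>lborel)"
      "(\<integral>x. Z_density p x * ((r x - c) * a x) \<partial>lborel) = 0 \<Longrightarrow>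
        AE x in lborel. 0 < x \<longrightarrow> a x \<noteq> 0 \<longrightarrow> r x = c"
      using R by blast+
  qed
  {
    fix b :: "real \<Rightarrow> real"
    assume b: "(\<forall>t. 0 \<le> b t) \<and> bounded (range b) \<and> mono b \<and> \<not> b constant_on {0..}"
    then have [measurable]: "b \<in> borel_measurable borel" by (auto intro: borel_measurable_mono)
    show "strict_antimono_on {1..} (\<lambda>p. \<integral>\<omega>. b (Z p \<omega>) \<partial>M p)"
    proof (rule monotone_onI)
      fix p q :: ereal assume "p \<in> {1..}" and pq: "p < q"
      then have p: "1 \<le> p" and q: "1 \<le> q" by auto
      define c where "c = (\<integral>\<omega>. b (Z q \<omega>) \<partial>M q)"
      \<comment> \<open>The factor 1 keeps the shape of \<open>compare\<close> with the constant
        weight \<open>a = 1\<close>.\<close>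
      have centred: "(\<integral>x. Z_density p x * ((b x - c) * 1) \<partial>lborel) = (\<integral>\<omega>. b (Z p \<omega>) \<partial>M p) - c"
        "integrable lborel (\<lambda>x. Z_density p x * ((b x - c) * 1))"
        if p: "1 \<le> p" for p
      proof -
        have mass: "(\<integral>x. Z_density p x * 1 \<partial>lborel) = 1"
          using ex[OF p, of "\<lambda>_. 1"] prob_space.prob_space[OF assms(1)[OF p]] by simp
        have I: "integrable lborel (\<lambda>x. Z_density p x * b x)" "integrable lborel (\<lambda>x. Z_density p x)"
          using int[OF p, of b] int[OF p, of "\<lambda>_. 1"] b by auto
        have eq: "Z_density p x * ((b x - c) * 1) = Z_density p x * b x - Z_density p x * c" for x
          by (simp add: algebra_simps)
        show "integrable lborel (\<lambda>x. Z_density p x * ((b x - c) * 1))"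
          unfolding eq using I by simp
        show "(\<integral>x. Z_density p x * ((b x - c) * 1) \<partial>lborel) = (\<integral>\<omega>. b (Z p \<omega>) \<partial>M p) - c"
          unfolding eq using I mass ex[OF p, of b] b by simp
      qed
      have zero: "(\<integral>x. Z_density q x * ((b x - c) * 1) \<partial>lborel) = 0"
        using centred(1)[OF q] by (simp add: c_def)
      note C = compare[OF p pq, of "\<lambda>_. 1" b c, OF _ _ _ _ _ zero]
      have "(\<integral>\<omega>. b (Z p \<omega>) \<partial>M p) \<noteq> c"
      proof
        assume "(\<integral>\<omega>. b (Z p \<omega>) \<partial>M p) = c"
        then have AE: "AE x in lborel. 0 < x \<longrightarrow> b x = c"
          using C(2) centred(1)[OF p] b by simp
        \<comment> \<open>Every \<open>x\<close> has a positive point above it at which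
          \<open>b\<close> equals \<open>c\<close>.\<close>
        have le: "b x \<le> c" for x
        proof -
          obtain y where "max 0 x < y" "b y = c"
            using AE_lborel_interval_witness[OF AE, of "max 0 x" "max 0 x + 1"] by auto
          then show ?thesis using monoD[of b x y] b by simp
        qed
        \<comment> \<open>The integrand at \<open>q\<close> is now known to be nonpositive, and its
          integral is 0.\<close>
        have "AE x in lborel. - (Z_density q x * ((b x - c) * 1)) = 0"
          by (subst integral_nonneg_eq_0_iff_AE[symmetric])
            (use centred(2)[OF q] zero le Z_density_nonneg[OF q] in
              \<open>auto simp: mult_nonneg_nonpos\<close>)
        then have AE': "AE x in lborel. x \<in> Z_support q \<longrightarrow> b x = c"
          by eventually_elim (use Z_density_pos[OF q] in force)
        obtain e where e: "0 < e" "\<And>x. - e < x \<Longrightarrow> x \<in> Z_support q"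
          using Z_support_neg[OF le_less_trans[OF p pq]] by blast
        \<comment> \<open>A point strictly left of 0 gives \<open>c \<le> b x\<close> for all
          \<open>x \<ge> 0\<close>, including \<open>x = 0\<close>.\<close>
        obtain y where "- e < y" "y < 0" "b y = c"
          using AE_lborel_interval_witness[OF AE', of "- e" 0] e by auto
        then have "b x = c" if "0 \<le> x" for x
          using monoD[of b y x] b le[of x] that by simp
        then show False using b by (auto simp: constant_on_def)
      qed
      then show "(\<integral>\<omega>. b (Z q \<omega>) \<partial>M q) < (\<integral>\<omega>. b (Z p \<omega>) \<partial>M p)"
        using C(1) centred(1)[OF p] b by (simp flip: c_def)
    qed
  }
  {
    fix a r :: "real \<Rightarrow> real"
    assume ar: "(\<forall>t. 0 \<le> a t) \<and> bounded (range a) \<and> a \<in> borel_measurable borel \<and>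
      (\<forall>t. 0 \<le> r t) \<and> bounded (range r) \<and> mono r \<and>
      \<not> lebesgue_constant_on r {t \<in> {0..}. a t \<noteq> 0}"
    then have [measurable]: "a \<in> borel_measurable borel" "r \<in> borel_measurable borel"
      by (auto intro: borel_measurable_mono)
    \<comment> \<open>Passing from the closed to the open half-line costs only the null set
      {0}.\<close>
    have not_const: "\<not> (AE x in lborel. 0 < x \<longrightarrow> a x \<noteq> 0 \<longrightarrow> r x = c)" for c
    proof
      assume "AE x in lborel. 0 < x \<longrightarrow> a x \<noteq> 0 \<longrightarrow> r x = c"
      moreover have "AE x in lborel. x \<noteq> (0 :: real)"
        by (rule AE_lborel_singleton)
      ultimately have "AE x in lborel. x \<notin> {x \<in> {t \<in> {0..}. a t \<noteq> 0}. r x \<noteq> c}"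
        by eventually_elim auto
      then have "{x \<in> {t \<in> {0..}. a t \<noteq> 0}. r x \<noteq> c} \<in> null_sets lborel"
        by (subst (asm) AE_iff_null_sets[symmetric]) auto
      then show False using ar by (auto simp: lebesgue_constant_on_def)
    qed
    have bdd: "bounded (range (\<lambda>x. r x * a x))"
      using ar by (intro bounded_range_mult) auto
    show "strict_antimono_on {1..}
      (\<lambda>p. (\<integral>\<omega>. r (Z p \<omega>) * a (Z p \<omega>) \<partial>M p) / (\<integral>\<omega>. a (Z p \<omega>) \<partial>M p))"
    proof (rule monotone_onI)
      fix p q :: ereal assume "p \<in> {1..}" and pq: "p < q"
      then have p: "1 \<le> p" and q: "1 \<le> q" by auto
      let ?A = "\<lambda>p. \<integral>\<omega>. a (Z p \<omega>) \<partial>M p" and ?B = "\<lambda>p. \<integral>\<omega>. r (Z p \<omega>) * a (Z p \<omega>) \<partial>M p"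
      have A_pos: "0 < ?A p" if p: "1 \<le> p" for p
      proof -
        have I: "integrable lborel (\<lambda>x. Z_density p x * a x)"
          using int[OF p, of a] ar by auto
        have nn: "0 \<le> Z_density p x * a x" for x
          using ar Z_density_nonneg[OF p] by auto
        have "(\<integral>x. Z_density p x * a x \<partial>lborel) \<noteq> 0"
        proof
          assume "(\<integral>x. Z_density p x * a x \<partial>lborel) = 0"
          then have "AE x in lborel. Z_density p x * a x = 0"
            by (subst integral_nonneg_eq_0_iff_AE[symmetric]) (use I nn in auto)
          \<comment> \<open>Here \<open>a\<close> vanishes almost everywhere on the positive
            half-line, so the implication holds vacuously; the value 0 for \<open>r\<close> is
            arbitrary.\<close>
          then have "AE x in lborel. 0 < x \<longrightarrow> a x \<noteq> 0 \<longrightarrow> r x = 0"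
            by eventually_elim (use Z_density_pos[OF p Z_support_pos[OF p]] in force)
          then show False using not_const by blast
        qed
        then show ?thesis
          using ex[OF p, of a] ar nn
            Bochner_Integration.integral_nonneg[of lborel "\<lambda>x. Z_density p x * a x"]
          by (simp add: less_le)
      qed
      \<comment> \<open>With this \<open>c\<close> the quantity \<open>?B p - c * ?A p\<close> is 0
        at \<open>q\<close>; its positivity at the smaller index is the claim after division by
        \<open>?A p\<close>.\<close>
      define c where "c = ?B q / ?A q"
      have centred: "(\<integral>x. Z_density p x * ((r x - c) * a x) \<partial>lborel) = ?B p - c * ?A p"
        if p: "1 \<le> p" for p
      proof -
        have I: "integrable lborel (\<lambda>x. Z_density p x * (r x * a x))"
          "integrable lborel (\<lambda>x. Z_density p x * a x)"
          using int[OF p, of a] int[OF p _ bdd] ar by auto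
        have "Z_density p x * ((r x - c) * a x) =
            Z_density p x * (r x * a x) - c * (Z_density p x * a x)" for x
          by (simp add: algebra_simps)
        then show ?thesis
          using I ex[OF p, of a] ex[OF p _ bdd] ar by simp
      qed
      have zero: "(\<integral>x. Z_density q x * ((r x - c) * a x) \<partial>lborel) = 0"
        using centred[OF q] A_pos[OF q] by (simp add: c_def)
      note C = compare[OF p pq, of a r c, OF _ _ _ _ _ zero]
      have "0 \<le> ?B p - c * ?A p"
        unfolding centred[OF p, symmetric] by (rule C(1)) (use ar in auto)
      moreover have "?B p - c * ?A p \<noteq> 0"
        unfolding centred[OF p, symmetric]
        by (rule notI, rule notE[OF not_const[of c]], rule C(2)) (use ar in auto)
      ultimately have "0 < ?B p - c * ?A p" by simp
      then have "c < ?B p / ?A p"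
        using A_pos[OF p] by (simp add: field_simps)
      then show "?B q / ?A q < ?B p / ?A p" by (simp add: c_def)
    qed
  }
qed

end
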